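(* Let $(X,\kappa)$ be a Lefschetz complex, let $\mathcal V$ be a combinatorial multivector field on $X$, and assume that $X$ is invariant with respect to $\mathcal V$. Let $S\subseteq X$ be an isolated invariant set. Then $S$ is an attractor if and only if $S$ is closed in $X$, and $S$ is a repeller if and only if $S$ is open in $X$.
   Context: Fix a ring $R$ with unity. A Lefschetz complex $(X,\kappa)$ is a finite set $X=\bigsqcup_{q\ge 0}X_q$ graded by non-negative integers with a map $\kappa:X\times X\to R$ such that $\kappa(x,y)\ne 0$ implies $x\in X_q$, $y\in X_{q-1}$ for some $q$, and $\sum_{y\in X}\kappa(x,y)\kappa(y,z)=0$ for all $x,z\in X$. Elements of $X$ are called cells. Let $\le_\kappa$ be the smallest partial order on $X$ with $y\le_\kappa x$ whenever $\kappa(x,y)\neq 0$. $X$ carries the topology whose open sets are the upper sets of $\le_\kappa$, so $\operatorname{cl}A=\{y\in X: y\le_\kappa x\text{ for some }x\in A\}$; write $\operatorname{cl}x=\operatorname{cl}\{x\}$ and $\operatorname{mo}A:=\operatorname{cl}A\setminus A$. A set $A\subseteq X$ is proper if $\operatorname{mo}A$ is closed. The Lefschetz homology $H^\kappa(X)$ is the homology of the free chain complex $R(X)$ with basis $X$ and $\partial x=\sum_y\kappa(x,y)y$; a proper subset with the restricted $\kappa$ is again a Lefschetz complex. A multivector is a proper $V\subseteq X$ with a unique maximal element $V^\star$ with respect to $\le_\kappa$; it is regular if $H^\kappa(V)=0$ and critical otherwise. A combinatorial multivector field $\mathcal V$ on $X$ is a partition of $X$ into multivectors; $[x]$ is the multivector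 containing $x$ and $x^\star:=[x]^\star$. The multivalued map $\Pi_{\mathcal V}:X\to\mathcal P(X)$ is defined by: $y\in\Pi_{\mathcal V}(x)$ iff (a) $x\ne y=x^\star$, or (b) $x=x^\star$ and $y\in\operatorname{cl}x\setminus[x]$, or (c) $x=x^\star=y$ and $[x]$ is critical. For $N\subseteq X$ put $\Pi_{\mathcal V}(N)=\bigcup_{x\in N}\Pi_{\mathcal V}(x)$ and $\Pi_{\mathcal V}^{-1}(N)=\{x:\Pi_{\mathcal V}(x)\cap N\ne\emptyset\}$. A solution is a map $\varphi$ from an interval of $\mathbb Z$ to $X$ with $\varphi(i+1)\in\Pi_{\mathcal V}(\varphi(i))$ whenever $i,i+1$ are in the domain; it is full if its domain is $\mathbb Z$ and a path if its domain is finite. $\operatorname{Sol}(x,A)$ is the set of full solutions with values in $A$ and with $x$ among their values. $A$ is $\mathcal V$-compatible if $x\in A$ implies $[x]\subseteq A$; $[A]_{\mathcal V}^-$ is the largest $\mathcal V$-compatible subset of $A$. $\operatorname{Inv}A:=\{x\in A:\operatorname{Sol}(x^\star,[A]_{\mathcal V}^-)\ne\emptyset\}$; $A$ is invariant if $\operatorname{Inv}A=A$. An isolated invariant set is an invariant set $S$ such that there is no path $\varphi$ whose values at both endpoints of its domain lie in $S$, with $\operatorname{im}\varphi\subseteq\operatorname{cl}S$ and $\operatorname{im}\varphi\cap\operatorname{mo}S\neq\emptyset$. A trapping region (resp. backward trapping region) is a $\mathcal V$-compatible $N\subseteq X$ with $\Pi_{\mathcal V}(N)\subseteq N$ (resp.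 $\Pi_{\mathcal V}^{-1}(N)\subseteq N$). An attractor (resp. repeller) is a set of the form $\operatorname{Inv}N$ with $N$ a trapping region (resp. backward trapping region). *)

theory Defs
  imports
    "HOL-Analysis.Abstract_Topology"
    "HOL-Algebra.Elementary_Groups"
    "HOL-Library.Disjoint_Sets"
begin

section \<open>Lefschetz complexes\<close>

text \<open>
  The values of \<open>dim\<close> and \<open>kappa\<close> outside \<open>cells\<close> are junk: no definition below depends on them.
  The grading is \<open>X\<^sub>q = {x \<in> cells. dim x = q}\<close>.
\<close>

record ('a, 'r) complex_data =
  cells :: "'a set"
  dim :: "'a \<Rightarrow> nat"
  kappa :: "'a \<Rightarrow> 'a \<Rightarrow> 'r"

text \<open>
  The sort \<open>{ring, monoid_mult}\<close> is that of rings with unity, not necessarily commutative; unlike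
  \<open>ring_1\<close> it does not exclude the zero ring.
\<close>

definition lefschetz_complex :: "('a, 'r::{ring, monoid_mult}) complex_data \<Rightarrow> bool" where
  "lefschetz_complex L \<longleftrightarrow>
     finite (cells L) \<and>
     (\<forall>x\<in>cells L. \<forall>y\<in>cells L. kappa L x y \<noteq> 0 \<longrightarrow> dim L x = dim L y + 1) \<and>
     (\<forall>x\<in>cells L. \<forall>z\<in>cells L. (\<Sum>y\<in>cells L. kappa L x y * kappa L y z) = 0)"

definition face_order :: "('a, 'r::zero) complex_data \<Rightarrow> ('a \<times> 'a) set" where
  "face_order L = (LEAST r. partial_order_on (cells L) r \<and>
     (\<forall>x\<in>cells L. \<forall>y\<in>cells L. kappa L x y \<noteq> 0 \<longrightarrow> (y, x) \<in> r))"

definition face_topology :: "('a, 'r::zero) complex_data \<Rightarrow> 'a topology" where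
  "face_topology L = topology (\<lambda>U. U \<subseteq> cells L \<and>
     (\<forall>x\<in>U. \<forall>y\<in>cells L. (x, y) \<in> face_order L \<longrightarrow> y \<in> U))"

abbreviation cl :: "('a, 'r::zero) complex_data \<Rightarrow> 'a set \<Rightarrow> 'a set" where
  "cl L A \<equiv> face_topology L closure_of A"

definition mo :: "('a, 'r::zero) complex_data \<Rightarrow> 'a set \<Rightarrow> 'a set" where
  "mo L A = cl L A - A"

definition proper :: "('a, 'r::zero) complex_data \<Rightarrow> 'a set \<Rightarrow> bool" where
  "proper L A \<longleftrightarrow> A \<subseteq> cells L \<and> closedin (face_topology L) (mo L A)"

definition restrict_complex ::
    "('a, 'r) complex_data \<Rightarrow> 'a set \<Rightarrow> ('a, 'r) complex_data" where
  "restrict_complex L A = L\<lparr>cells := A\<rparr>"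


section \<open>Lefschetz homology\<close>

text \<open>
  The free left \<open>R\<close>-module on the \<open>q\<close>-cells; a chain is given by its coefficient function, extended
  by 0 (there are only finitely many cells).
\<close>

definition chains :: "('a, 'r::zero) complex_data \<Rightarrow> nat \<Rightarrow> ('a \<Rightarrow> 'r) set" where
  "chains L q = {c. \<forall>x. c x \<noteq> 0 \<longrightarrow> x \<in> cells L \<and> dim L x = q}"

text \<open>The linear extension of \<open>x \<mapsto> \<Sum>\<^sub>y \<kappa>(x,y) y\<close>.\<close>

definition boundary :: "('a, 'r::semiring_0) complex_data \<Rightarrow> ('a \<Rightarrow> 'r) \<Rightarrow> ('a \<Rightarrow> 'r)" where
  "boundary L c = (\<lambda>y. if y \<in> cells L then \<Sum>x\<in>cells L. c x * kappa L x y else 0)"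

definition cycles :: "('a, 'r::semiring_0) complex_data \<Rightarrow> nat \<Rightarrow> ('a \<Rightarrow> 'r) set" where
  "cycles L q = {c \<in> chains L q. boundary L c = (\<lambda>_. 0)}"

definition boundaries :: "('a, 'r::semiring_0) complex_data \<Rightarrow> nat \<Rightarrow> ('a \<Rightarrow> 'r) set" where
  "boundaries L q = boundary L ` chains L (Suc q)"

definition cycle_group :: "('a, 'r::semiring_0) complex_data \<Rightarrow> nat \<Rightarrow> ('a \<Rightarrow> 'r) monoid" where
  "cycle_group L q =
     \<lparr>carrier = cycles L q, monoid.mult = (\<lambda>c c' x. c x + c' x), one = (\<lambda>_. 0)\<rparr>"

text \<open>Only the additive group of the homology module is recorded, which suffices for vanishing.\<close>

definition lefschetz_homology ::
    "('a, 'r::semiring_0) complex_data \<Rightarrow> nat \<Rightarrow> ('a \<Rightarrow> 'r) set monoid" where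
  "lefschetz_homology L q = cycle_group L q Mod boundaries L q"

definition zero_homology :: "('a, 'r::semiring_0) complex_data \<Rightarrow> bool" where
  "zero_homology L \<longleftrightarrow> (\<forall>q. trivial_group (lefschetz_homology L q))"


section \<open>Combinatorial multivector fields\<close>

definition maximal_cell :: "('a, 'r::zero) complex_data \<Rightarrow> 'a set \<Rightarrow> 'a \<Rightarrow> bool" where
  "maximal_cell L V m \<longleftrightarrow> m \<in> V \<and> (\<forall>y\<in>V. (m, y) \<in> face_order L \<longrightarrow> y = m)"

definition multivector :: "('a, 'r::zero) complex_data \<Rightarrow> 'a set \<Rightarrow> bool" where
  "multivector L V \<longleftrightarrow> proper L V \<and> (\<exists>!m. maximal_cell L V m)"

definition top_cell :: "('a, 'r::zero) complex_data \<Rightarrow> 'a set \<Rightarrow> 'a" where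
  "top_cell L V = (THE m. maximal_cell L V m)"

definition regular :: "('a, 'r::semiring_0) complex_data \<Rightarrow> 'a set \<Rightarrow> bool" where
  "regular L V \<longleftrightarrow> multivector L V \<and> zero_homology (restrict_complex L V)"

definition critical :: "('a, 'r::semiring_0) complex_data \<Rightarrow> 'a set \<Rightarrow> bool" where
  "critical L V \<longleftrightarrow> multivector L V \<and> \<not> regular L V"

definition multivector_field :: "('a, 'r::zero) complex_data \<Rightarrow> 'a set set \<Rightarrow> bool" where
  "multivector_field L \<V> \<longleftrightarrow> partition_on (cells L) \<V> \<and> (\<forall>V\<in>\<V>. multivector L V)"

definition mv_of :: "'a set set \<Rightarrow> 'a \<Rightarrow> 'a set" where
  "mv_of \<V> x = (THE V. V \<in> \<V> \<and> x \<in> V)"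

definition star :: "('a, 'r::zero) complex_data \<Rightarrow> 'a set set \<Rightarrow> 'a \<Rightarrow> 'a" where
  "star L \<V> x = top_cell L (mv_of \<V> x)"

definition Pi_mv :: "('a, 'r::semiring_0) complex_data \<Rightarrow> 'a set set \<Rightarrow> 'a \<Rightarrow> 'a set" where
  "Pi_mv L \<V> x = {y \<in> cells L. x \<in> cells L \<and>
     ((x \<noteq> y \<and> y = star L \<V> x) \<or>
      (x = star L \<V> x \<and> y \<in> cl L {x} - mv_of \<V> x) \<or>
      (x = star L \<V> x \<and> x = y \<and> critical L (mv_of \<V> x)))}"

definition Pi_image :: "('a, 'r::semiring_0) complex_data \<Rightarrow> 'a set set \<Rightarrow> 'a set \<Rightarrow> 'a set" where
  "Pi_image L \<V> N = (\<Union>x\<in>N. Pi_mv L \<V> x)"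

definition Pi_preimage :: "('a, 'r::semiring_0) complex_data \<Rightarrow> 'a set set \<Rightarrow> 'a set \<Rightarrow> 'a set" where
  "Pi_preimage L \<V> N = {x \<in> cells L. Pi_mv L \<V> x \<inter> N \<noteq> {}}"


section \<open>Solutions and invariant sets\<close>

definition int_interval :: "int set \<Rightarrow> bool" where
  "int_interval I \<longleftrightarrow> (\<forall>i\<in>I. \<forall>j\<in>I. {i..j} \<subseteq> I)"

text \<open>Only the values of \<open>\<phi>\<close> on the domain \<open>I\<close> matter.\<close>

definition solution ::
    "('a, 'r::semiring_0) complex_data \<Rightarrow> 'a set set \<Rightarrow> int set \<Rightarrow> (int \<Rightarrow> 'a) \<Rightarrow> bool" where
  "solution L \<V> I \<phi> \<longleftrightarrow> int_interval I \<and> \<phi> ` I \<subseteq> cells L \<and>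
     (\<forall>i. i \<in> I \<and> i + 1 \<in> I \<longrightarrow> \<phi> (i + 1) \<in> Pi_mv L \<V> (\<phi> i))"

definition full_solution ::
    "('a, 'r::semiring_0) complex_data \<Rightarrow> 'a set set \<Rightarrow> (int \<Rightarrow> 'a) \<Rightarrow> bool" where
  "full_solution L \<V> \<phi> \<longleftrightarrow> solution L \<V> UNIV \<phi>"

text \<open>Domains of paths are nonempty, so that the endpoints \<open>Min I\<close> and \<open>Max I\<close> exist.\<close>

definition is_path ::
    "('a, 'r::semiring_0) complex_data \<Rightarrow> 'a set set \<Rightarrow> int set \<Rightarrow> (int \<Rightarrow> 'a) \<Rightarrow> bool" where
  "is_path L \<V> I \<phi> \<longleftrightarrow> solution L \<V> I \<phi> \<and> finite I \<and> I \<noteq> {}"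

definition Sol ::
    "('a, 'r::semiring_0) complex_data \<Rightarrow> 'a set set \<Rightarrow> 'a \<Rightarrow> 'a set \<Rightarrow> (int \<Rightarrow> 'a) set" where
  "Sol L \<V> x A = {\<phi>. full_solution L \<V> \<phi> \<and> range \<phi> \<subseteq> A \<and> x \<in> range \<phi>}"

definition compatible :: "'a set set \<Rightarrow> 'a set \<Rightarrow> bool" where
  "compatible \<V> A \<longleftrightarrow> (\<forall>x\<in>A. mv_of \<V> x \<subseteq> A)"

definition compatible_core :: "'a set set \<Rightarrow> 'a set \<Rightarrow> 'a set" where
  "compatible_core \<V> A = (GREATEST B. B \<subseteq> A \<and> compatible \<V> B)"

definition Inv :: "('a, 'r::semiring_0) complex_data \<Rightarrow> 'a set set \<Rightarrow> 'a set \<Rightarrow> 'a set" where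
  "Inv L \<V> A = {x \<in> A. Sol L \<V> (star L \<V> x) (compatible_core \<V> A) \<noteq> {}}"

definition invariant :: "('a, 'r::semiring_0) complex_data \<Rightarrow> 'a set set \<Rightarrow> 'a set \<Rightarrow> bool" where
  "invariant L \<V> A \<longleftrightarrow> A \<subseteq> cells L \<and> Inv L \<V> A = A"

definition isolated_invariant ::
    "('a, 'r::semiring_0) complex_data \<Rightarrow> 'a set set \<Rightarrow> 'a set \<Rightarrow> bool" where
  "isolated_invariant L \<V> S \<longleftrightarrow> invariant L \<V> S \<and>
     \<not> (\<exists>I \<phi>. is_path L \<V> I \<phi> \<and> \<phi> (Min I) \<in> S \<and> \<phi> (Max I) \<in> S \<and>
            \<phi> ` I \<subseteq> cl L S \<and> \<phi> ` I \<inter> mo L S \<noteq> {})"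

definition trapping_region ::
    "('a, 'r::semiring_0) complex_data \<Rightarrow> 'a set set \<Rightarrow> 'a set \<Rightarrow> bool" where
  "trapping_region L \<V> N \<longleftrightarrow> N \<subseteq> cells L \<and> compatible \<V> N \<and> Pi_image L \<V> N \<subseteq> N"

definition backward_trapping_region ::
    "('a, 'r::semiring_0) complex_data \<Rightarrow> 'a set set \<Rightarrow> 'a set \<Rightarrow> bool" where
  "backward_trapping_region L \<V> N \<longleftrightarrow> N \<subseteq> cells L \<and> compatible \<V> N \<and> Pi_preimage L \<V> N \<subseteq> N"

definition attractor :: "('a, 'r::semiring_0) complex_data \<Rightarrow> 'a set set \<Rightarrow> 'a set \<Rightarrow> bool" where
  "attractor L \<V> S \<longleftrightarrow> (\<exists>N. trapping_region L \<V> N \<and> S = Inv L \<V> N)"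

definition repeller :: "('a, 'r::semiring_0) complex_data \<Rightarrow> 'a set set \<Rightarrow> 'a set \<Rightarrow> bool" where
  "repeller L \<V> S \<longleftrightarrow> (\<exists>N. backward_trapping_region L \<V> N \<and> S = Inv L \<V> N)"


section \<open>Explicit forms of the face order, the topology and the compatible core\<close>

lemma compatible_core_eq: "compatible_core \<V> A = \<Union>{B. B \<subseteq> A \<and> compatible \<V> B}"
  unfolding compatible_core_def
proof (rule Greatest_equality)
  show "\<Union>{B. B \<subseteq> A \<and> compatible \<V> B} \<subseteq> A \<and> compatible \<V> (\<Union>{B. B \<subseteq> A \<and> compatible \<V> B})"
    unfolding compatible_def by blast
qed blast

lemma face_order_eq:
  fixes L :: "('a, 'r::{ring, monoid_mult}) complex_data"
  assumes "lefschetz_complex L"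
  shows "face_order L =
    Id_on (cells L) \<union> {(y, x). x \<in> cells L \<and> y \<in> cells L \<and> kappa L x y \<noteq> 0}\<^sup>+"
    (is "_ = ?I \<union> ?E\<^sup>+")
  unfolding face_order_def
proof (rule Least_equality)
  have lt: "dim L y < dim L x" if "(y, x) \<in> ?E\<^sup>+" for x y
    using that
    by (induction rule: trancl_induct) (use assms in \<open>force simp: lefschetz_complex_def\<close>)+
  have sub: "?E\<^sup>+ \<subseteq> cells L \<times> cells L"
    by (rule trancl_subset_Sigma) auto
  have "trans (?I \<union> ?E\<^sup>+)"
    by (rule transI) (auto intro: trancl_trans)
  moreover have "antisym (?I \<union> ?E\<^sup>+)"
    by (rule antisymI) (auto dest!: lt)
  ultimately show "partial_order_on (cells L) (?I \<union> ?E\<^sup>+) \<and>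
      (\<forall>x\<in>cells L. \<forall>y\<in>cells L. kappa L x y \<noteq> 0 \<longrightarrow> (y, x) \<in> ?I \<union> ?E\<^sup>+)"
    using sub by (auto simp: partial_order_on_def preorder_on_def refl_on_def)
next
  fix r
  assume r: "partial_order_on (cells L) r \<and>
      (\<forall>x\<in>cells L. \<forall>y\<in>cells L. kappa L x y \<noteq> 0 \<longrightarrow> (y, x) \<in> r)"
  have "?E \<subseteq> r" "trans r" "?I \<subseteq> r"
    using r by (auto simp: partial_order_on_def preorder_on_def refl_on_def)
  moreover have "?E\<^sup>+ \<subseteq> r"
    using trancl_mono_subset[OF \<open>?E \<subseteq> r\<close>] trancl_id[OF \<open>trans r\<close>] by simp
  ultimately show "?I \<union> ?E\<^sup>+ \<subseteq> r" by blast
qed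

lemma openin_face_topology:
  "openin (face_topology L) U \<longleftrightarrow>
     U \<subseteq> cells L \<and> (\<forall>x\<in>U. \<forall>y\<in>cells L. (x, y) \<in> face_order L \<longrightarrow> y \<in> U)"
proof -
  have "istopology (\<lambda>U. U \<subseteq> cells L \<and>
     (\<forall>x\<in>U. \<forall>y\<in>cells L. (x, y) \<in> face_order L \<longrightarrow> y \<in> U))"
    unfolding istopology_def by blast
  then show ?thesis
    by (simp add: face_topology_def topology_inverse')
qed

lemma topspace_face_topology: "topspace (face_topology L) = cells L"
  unfolding topspace_def openin_face_topology by blast

lemma cl_eq:
  fixes L :: "('a, 'r::{ring, monoid_mult}) complex_data"
  assumes "lefschetz_complex L" "A \<subseteq> cells L"
  shows "cl L A = {y \<in> cells L. \<exists>x\<in>A. (y, x) \<in> face_order L}"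
proof -
  have tr: "trans (face_order L)"
    unfolding face_order_eq[OF assms(1)] by (rule transI) (auto intro: trancl_trans)
  show ?thesis
  proof (intro equalityI subsetI)
    fix y
    assume y: "y \<in> cl L A"
    let ?U = "{z \<in> cells L. (y, z) \<in> face_order L}"
    have yX: "y \<in> cells L"
      using y by (simp add: in_closure_of topspace_face_topology)
    have "openin (face_topology L) ?U"
      unfolding openin_face_topology using transD[OF tr] by blast
    moreover have "y \<in> ?U"
      using yX by (simp add: face_order_eq[OF assms(1)] Id_on_iff)
    ultimately obtain x where "x \<in> A" "x \<in> ?U"
      using y unfolding in_closure_of by meson
    then show "y \<in> {y \<in> cells L. \<exists>x\<in>A. (y, x) \<in> face_order L}"
      using yX by blast
  next
    fix y
    assume "y \<in> {y \<in> cells L. \<exists>x\<in>A. (y, x) \<in> face_order L}"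
    then show "y \<in> cl L A"
      unfolding in_closure_of topspace_face_topology openin_face_topology
      using assms(2) by blast
  qed
qed

end

(*
  An invariant set S is V-compatible and carries a full solution through each of its top cells. For
  V-compatible sets, "closed" means "forward closed under the multivalued map" and "open" means
  "backward closed"; hence a closed (open) S is its own trapping region (backward trapping region).
  Conversely, let S = Inv N with N a trapping region, x in S and y a face of x outside the multivector
  of x. A full solution through the top cell of y is obtained by following one in N from the past to
  the top cell of x, stepping to y and its top cell, and going on along a solution in X, which stays
  in N because N is trapping. The repeller case is the time reverse.
*)
theory Submission imports Defs begin

section \<open>One-sided infinite orbits and their gluing into full solutions\<close>

definition viable :: "('a \<Rightarrow> 'a \<Rightarrow> bool) \<Rightarrow> 'a set \<Rightarrow> 'a \<Rightarrow> bool" where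
  "viable R A x \<longleftrightarrow> (\<exists>g :: nat \<Rightarrow> 'a. g 0 = x \<and> range g \<subseteq> A \<and> (\<forall>n. R (g n) (g (Suc n))))"

lemma viable_step:
  assumes "x \<in> A" "R x y" "viable R A y"
  shows "viable R A x"
proof -
  obtain g where g: "g 0 = y" "range g \<subseteq> A" "\<And>n. R (g n) (g (Suc n))"
    using assms(3) unfolding viable_def by blast
  have "R (case_nat x g n) (case_nat x g (Suc n))" for n
    using g assms(2) by (cases n) auto
  moreover have "range (case_nat x g) \<subseteq> A"
    using g(2) assms(1) by (fastforce split: nat.splits)
  ultimately show ?thesis
    unfolding viable_def by (intro exI[of _ "case_nat x g"]) simp
qed

text \<open>Induction along the orbit: it cannot leave a set closed under \<open>R\<close>. This
  later confines half solutions in \<open>cells L\<close> to a trapping region or, backward in time,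
  to a backward trapping region.\<close>

lemma viable_trapped:
  assumes "viable R B x" "x \<in> A"
    and closed: "\<And>y z. y \<in> A \<Longrightarrow> R y z \<Longrightarrow> z \<in> A"
  shows "viable R A x"
proof -
  obtain g where g: "g 0 = x" "\<And>n. R (g n) (g (Suc n))"
    using assms(1) unfolding viable_def by blast
  have "g n \<in> A" for n
    by (induction n) (use g assms(2) closed in auto)
  then show ?thesis
    using g unfolding viable_def by blast
qed

abbreviation forward_step ::
    "('a, 'r::semiring_0) complex_data \<Rightarrow> 'a set set \<Rightarrow> 'a \<Rightarrow> 'a \<Rightarrow> bool" where
  "forward_step L \<V> x y \<equiv> y \<in> Pi_mv L \<V> x"

text \<open>Along the reversed relation an orbit is an infinite past, so the lemmas on
  \<open>viable\<close>, stated for arbitrary \<open>R\<close>, serve both time directions. In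
  particular, \<open>viable_step\<close> then appends to a past a point that comes later in
  time.\<close>

abbreviation backward_step ::
    "('a, 'r::semiring_0) complex_data \<Rightarrow> 'a set set \<Rightarrow> 'a \<Rightarrow> 'a \<Rightarrow> bool" where
  "backward_step L \<V> x y \<equiv> x \<in> Pi_mv L \<V> y"

text \<open>A full solution can be cut at any visit to \<open>x\<close>, and any future and past of
  \<open>x\<close> can be glued there. The two halves may therefore be chosen independently, which
  later arguments exploit.\<close>

lemma Sol_nonempty_iff:
  assumes "A \<subseteq> cells L"
  shows "Sol L \<V> x A \<noteq> {} \<longleftrightarrow>
    viable (forward_step L \<V>) A x \<and> viable (backward_step L \<V>) A x"
proof
  assume "Sol L \<V> x A \<noteq> {}"
  then obtain \<phi> where "\<phi> \<in> Sol L \<V> x A" by blast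
  \<comment> \<open>\<open>Sol\<close> does not fix the time of the visit to \<open>x\<close>; both
    halves are counted from some such time \<open>k\<close>.\<close>
  then obtain k where \<phi>: "range \<phi> \<subseteq> A" "\<phi> k = x" "\<And>i. \<phi> (i + 1) \<in> Pi_mv L \<V> (\<phi> i)"
    unfolding Sol_def full_solution_def solution_def by blast
  have "viable (forward_step L \<V>) A x"
    unfolding viable_def
  proof (intro exI[of _ "\<lambda>n. \<phi> (k + int n)"] conjI allI)
    show "\<phi> (k + int (Suc n)) \<in> Pi_mv L \<V> (\<phi> (k + int n))" for n
      using \<phi>(3)[of "k + int n"] by (simp add: ac_simps)
  qed (use \<phi> in auto)
  moreover have "viable (backward_step L \<V>) A x"
    unfolding viable_def
  proof (intro exI[of _ "\<lambda>n. \<phi> (k - int n)"] conjI allI)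
    show "\<phi> (k - int n) \<in> Pi_mv L \<V> (\<phi> (k - int (Suc n)))" for n
      using \<phi>(3)[of "k - int (Suc n)"] by (simp add: algebra_simps)
  qed (use \<phi> in auto)
  ultimately show "viable (forward_step L \<V>) A x \<and> viable (backward_step L \<V>) A x" ..
next
  assume "viable (forward_step L \<V>) A x \<and> viable (backward_step L \<V>) A x"
  then obtain f g where
    f: "f 0 = x" "range f \<subseteq> A" "\<And>n. f (Suc n) \<in> Pi_mv L \<V> (f n)" and
    g: "g 0 = x" "range g \<subseteq> A" "\<And>n. g n \<in> Pi_mv L \<V> (g (Suc n))"
    unfolding viable_def by blast
  define \<phi> where "\<phi> i = (if 0 \<le> i then f (nat i) else g (nat (- i)))" for i :: int
  have "\<phi> (i + 1) \<in> Pi_mv L \<V> (\<phi> i)" for i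
  proof (cases "0 \<le> i")
    case True
    then show ?thesis
      using f(3)[of "nat i"] by (simp add: \<phi>_def nat_add_distrib)
  next
    case False
    then have "nat (- i) = Suc (nat (- (i + 1)))" by simp
    \<comment> \<open>The halves meet only at \<open>i = - 1\<close>, where \<open>\<phi> 0\<close>
      is \<open>f 0\<close> by definition and \<open>g 0\<close> is needed; both equal
      \<open>x\<close>.\<close>
    moreover have "\<phi> (i + 1) = g (nat (- (i + 1)))"
      using False f(1) g(1) by (cases "i = - 1") (auto simp: \<phi>_def)
    ultimately show ?thesis
      using False g(3)[of "nat (- (i + 1))"] by (simp add: \<phi>_def)
  qed
  moreover have "range \<phi> \<subseteq> A"
    using f(2) g(2) by (auto simp: \<phi>_def)
  moreover have "x \<in> range \<phi>"
    by (rule range_eqI[of _ _ 0]) (simp add: \<phi>_def f(1))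
  ultimately have "\<phi> \<in> Sol L \<V> x A"
    using assms unfolding Sol_def full_solution_def solution_def int_interval_def by auto
  then show "Sol L \<V> x A \<noteq> {}" by blast
qed

lemma compatible_core_id: "compatible \<V> A \<Longrightarrow> compatible_core \<V> A = A"
  unfolding compatible_core_eq by blast

lemma Inv_compatible:
  assumes "A \<subseteq> cells L" "compatible \<V> A"
  shows "Inv L \<V> A = {x \<in> A. viable (forward_step L \<V>) A (star L \<V> x) \<and>
    viable (backward_step L \<V>) A (star L \<V> x)}"
  unfolding Inv_def compatible_core_id[OF assms(2)] Sol_nonempty_iff[OF assms(1)] ..

context
  fixes L :: "('a, 'r::{ring, monoid_mult}) complex_data" and \<V> :: "'a set set"
  assumes complex: "lefschetz_complex L" and field: "multivector_field L \<V>"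
begin

section \<open>The face order, with open and closed sets as its upper and lower sets\<close>

lemma face_order_partial_order: "partial_order_on (cells L) (face_order L)"
proof -
  have sub: "{(y, x). x \<in> cells L \<and> y \<in> cells L \<and> kappa L x y \<noteq> 0}\<^sup>+ \<subseteq> cells L \<times> cells L"
    (is "?E\<^sup>+ \<subseteq> _")
    by (rule trancl_subset_Sigma) auto
  \<comment> \<open>Each generating pair raises the dimension by one, so the transitive closure has
    no cycles; antisymmetry rests on this.\<close>
  have lt: "dim L y < dim L x" if "(y, x) \<in> ?E\<^sup>+" for x y
    using that
    by (induction rule: trancl_induct) (use complex in \<open>force simp: lefschetz_complex_def\<close>)+
  have "trans (face_order L)"
    unfolding face_order_eq[OF complex] by (rule transI) (auto intro: trancl_trans)
  moreover have "antisym (face_order L)"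
    unfolding face_order_eq[OF complex] by (rule antisymI) (auto dest!: lt)
  ultimately show ?thesis
    unfolding partial_order_on_def preorder_on_def refl_on_def
    using sub by (auto simp: face_order_eq[OF complex])
qed

lemma face_order_refl: "x \<in> cells L \<Longrightarrow> (x, x) \<in> face_order L"
  and face_order_trans:
    "(x, y) \<in> face_order L \<Longrightarrow> (y, z) \<in> face_order L \<Longrightarrow> (x, z) \<in> face_order L"
  and face_order_antisym:
    "(x, y) \<in> face_order L \<Longrightarrow> (y, x) \<in> face_order L \<Longrightarrow> x = y"
  and face_order_cells: "(x, y) \<in> face_order L \<Longrightarrow> x \<in> cells L \<and> y \<in> cells L"
  using face_order_partial_order
  by (auto simp: partial_order_on_def preorder_on_def refl_on_def dest: transD antisymD)

lemma mem_cl_singleton: "x \<in> cells L \<Longrightarrow> y \<in> cl L {x} \<longleftrightarrow> (y, x) \<in> face_order L"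
  using cl_eq[OF complex, of "{x}"] face_order_cells by auto

lemma openin_iff_upper:
  "openin (face_topology L) U \<longleftrightarrow>
    U \<subseteq> cells L \<and> (\<forall>x\<in>U. \<forall>y. (x, y) \<in> face_order L \<longrightarrow> y \<in> U)"
  unfolding openin_face_topology using face_order_cells by blast

lemma closedin_iff_lower:
  "closedin (face_topology L) C \<longleftrightarrow>
    C \<subseteq> cells L \<and> (\<forall>x\<in>C. \<forall>y. (y, x) \<in> face_order L \<longrightarrow> y \<in> C)"
  unfolding closedin_def openin_iff_upper topspace_face_topology using face_order_cells by blast

section \<open>Multivectors and their top cells\<close>

lemma mv_of_eqI: "V \<in> \<V> \<Longrightarrow> x \<in> V \<Longrightarrow> mv_of \<V> x = V"
  using field unfolding mv_of_def multivector_field_def partition_on_def disjoint_def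
  by (intro the_equality) blast+

lemma
  assumes "x \<in> cells L"
  shows mv_of_mem: "mv_of \<V> x \<in> \<V>" and mem_mv_of: "x \<in> mv_of \<V> x"
proof -
  obtain V where "V \<in> \<V>" "x \<in> V"
    using assms field unfolding multivector_field_def partition_on_def by blast
  then show "mv_of \<V> x \<in> \<V>" "x \<in> mv_of \<V> x"
    by (simp_all add: mv_of_eqI)
qed

lemma mv_of_subset: "x \<in> cells L \<Longrightarrow> mv_of \<V> x \<subseteq> cells L"
  using mv_of_mem field unfolding multivector_field_def partition_on_def by blast

lemma mv_of_cong: "x \<in> cells L \<Longrightarrow> y \<in> mv_of \<V> x \<Longrightarrow> mv_of \<V> y = mv_of \<V> x"
  by (rule mv_of_eqI[OF mv_of_mem])

lemma exists_maximal_above: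
  assumes "V \<subseteq> cells L" "x \<in> V"
  shows "\<exists>m. maximal_cell L V m \<and> (x, m) \<in> face_order L"
proof -
  have "finite V"
    using assms(1) complex finite_subset unfolding lefschetz_complex_def by blast
  then show ?thesis
    using assms(2)
  proof (induction "card {y \<in> V. (x, y) \<in> face_order L}" arbitrary: x rule: less_induct)
    case less
    show ?case
    proof (cases "maximal_cell L V x")
      case True
      then show ?thesis
        using face_order_refl less.prems assms(1) by blast
    next
      case False
      then obtain y where y: "y \<in> V" "(x, y) \<in> face_order L" "y \<noteq> x"
        using less.prems unfolding maximal_cell_def by blast
      \<comment> \<open>Strict because \<open>x\<close> belongs to the right-hand set but, by
        antisymmetry, not to the left-hand one; this makes the induction on the number of cells
        above \<open>x\<close> work.\<close>
      have "{z \<in> V. (y, z) \<in> face_order L} \<subset> {z \<in> V. (x, z) \<in> face_order L}"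
        using y less.prems face_order_trans face_order_antisym face_order_refl assms(1) by blast
      then have "card {z \<in> V. (y, z) \<in> face_order L} < card {z \<in> V. (x, z) \<in> face_order L}"
        using less.prems by (intro psubset_card_mono) auto
      then show ?thesis
        using less.hyps[OF _ less.prems(1) y(1)] face_order_trans[OF y(2)] by blast
    qed
  qed
qed

text \<open>Some maximal cell of the multivector lies above \<open>x\<close>, and uniqueness
  identifies it with the top cell; the top cell is thus a greatest element, not only a maximal
  one.\<close>

lemma
  assumes "x \<in> cells L"
  shows star_mem: "star L \<V> x \<in> mv_of \<V> x"
    and star_above: "(x, star L \<V> x) \<in> face_order L"
proof -
  have unique: "\<exists>!m. maximal_cell L (mv_of \<V> x) m"
    using field mv_of_mem[OF assms] unfolding multivector_field_def multivector_def by blast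
  obtain m where m: "maximal_cell L (mv_of \<V> x) m" "(x, m) \<in> face_order L"
    using exists_maximal_above[OF mv_of_subset mem_mv_of] assms by blast
  have "star L \<V> x = m"
    unfolding star_def top_cell_def using unique m(1) by (rule the1_equality)
  then show "star L \<V> x \<in> mv_of \<V> x" "(x, star L \<V> x) \<in> face_order L"
    using m unfolding maximal_cell_def by auto
qed

lemma star_cells: "x \<in> cells L \<Longrightarrow> star L \<V> x \<in> cells L"
  using star_mem mv_of_subset by blast

lemma mv_of_star: "x \<in> cells L \<Longrightarrow> mv_of \<V> (star L \<V> x) = mv_of \<V> x"
  using mv_of_cong star_mem by blast

lemma star_star: "x \<in> cells L \<Longrightarrow> star L \<V> (star L \<V> x) = star L \<V> x"
  by (metis mv_of_star star_def)

section \<open>Steps of the multivalued map against closed and open sets\<close>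

lemma star_step: "x \<in> cells L \<Longrightarrow> x \<noteq> star L \<V> x \<Longrightarrow> star L \<V> x \<in> Pi_mv L \<V> x"
  unfolding Pi_mv_def using star_cells by blast

text \<open>Only top cells step down to their faces. By transitivity a face of \<open>x\<close> is
  also a face of the top cell above \<open>x\<close>, which has the same multivector.\<close>

lemma face_step:
  assumes "(y, x) \<in> face_order L" "y \<notin> mv_of \<V> x"
  shows "y \<in> Pi_mv L \<V> (star L \<V> x)"
proof -
  have cells: "x \<in> cells L" "y \<in> cells L"
    using face_order_cells[OF assms(1)] by auto
  have "(y, star L \<V> x) \<in> face_order L"
    using face_order_trans[OF assms(1) star_above] cells by blast
  then show ?thesis
    unfolding Pi_mv_def using cells assms(2)
    by (simp add: star_cells star_star mv_of_star mem_cl_singleton)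
qed

text \<open>A rough bound on steps, enough to keep them inside any closed compatible set.\<close>

lemma Pi_mv_cases:
  assumes "y \<in> Pi_mv L \<V> x"
  shows "y \<in> mv_of \<V> x \<or> (y, x) \<in> face_order L"
  using assms star_mem mem_mv_of mem_cl_singleton unfolding Pi_mv_def by blast

lemma compatible_mv_of_iff:
  assumes "N \<subseteq> cells L" "compatible \<V> N" "x \<in> cells L" "y \<in> mv_of \<V> x"
  shows "y \<in> N \<longleftrightarrow> x \<in> N"
  using assms mv_of_cong[OF assms(3,4)] mem_mv_of unfolding compatible_def by blast

lemma Pi_image_subset_iff_closed:
  assumes N: "N \<subseteq> cells L" "compatible \<V> N"
  shows "Pi_image L \<V> N \<subseteq> N \<longleftrightarrow> closedin (face_topology L) N"
proof
  assume trap: "Pi_image L \<V> N \<subseteq> N"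
  have "y \<in> N" if "x \<in> N" "(y, x) \<in> face_order L" for x y
  proof (cases "y \<in> mv_of \<V> x")
    case True
    then show ?thesis using that N unfolding compatible_def by blast
  next
    case False
    \<comment> \<open>The step down to \<open>y\<close> starts at the top cell, not at
      \<open>x\<close>; compatibility places that cell in \<open>N\<close>.\<close>
    have "star L \<V> x \<in> N"
      using that N star_mem unfolding compatible_def by blast
    then show ?thesis
      using face_step[OF that(2) False] trap unfolding Pi_image_def by blast
  qed
  then show "closedin (face_topology L) N"
    using N closedin_iff_lower by blast
next
  assume "closedin (face_topology L) N"
  then show "Pi_image L \<V> N \<subseteq> N"
    using N Pi_mv_cases unfolding closedin_iff_lower Pi_image_def compatible_def by blast
qed

lemma compatible_Compl:
  assumes "N \<subseteq> cells L" "compatible \<V> N"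
  shows "compatible \<V> (cells L - N)"
  unfolding compatible_def using compatible_mv_of_iff[OF assms] mv_of_subset by blast

text \<open>Complementation reverses time: no step enters \<open>N\<close> from outside exactly when
  no step leaves the complement, which is again a union of multivectors.\<close>

lemma Pi_preimage_subset_iff_open:
  assumes N: "N \<subseteq> cells L" "compatible \<V> N"
  shows "Pi_preimage L \<V> N \<subseteq> N \<longleftrightarrow> openin (face_topology L) N"
proof -
  have "Pi_preimage L \<V> N \<subseteq> N \<longleftrightarrow> Pi_image L \<V> (cells L - N) \<subseteq> cells L - N"
    unfolding Pi_preimage_def Pi_image_def Pi_mv_def by blast
  also have "\<dots> \<longleftrightarrow> closedin (face_topology L) (cells L - N)"
    by (rule Pi_image_subset_iff_closed) (use compatible_Compl[OF N] in auto)
  also have "\<dots> \<longleftrightarrow> openin (face_topology L) N"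
    using N(1) by (simp add: openin_closedin_eq topspace_face_topology)
  finally show ?thesis .
qed

section \<open>Compatibility of invariant sets, and transfer of orbits between a cell and its top
  cell\<close>

lemma invariant_compatible:
  assumes "invariant L \<V> S"
  shows "compatible \<V> S"
  unfolding compatible_def
proof
  fix x
  assume x: "x \<in> S"
  then have "x \<in> cells L" "Sol L \<V> (star L \<V> x) (compatible_core \<V> S) \<noteq> {}"
    using assms unfolding invariant_def Inv_def by blast+
  \<comment> \<open>The solution stays in the compatible core and visits the top cell, so one of the
    compatible subsets whose union is the core contains that cell.\<close>
  then obtain B where "B \<subseteq> S" "compatible \<V> B" "star L \<V> x \<in> B"
    unfolding Sol_def compatible_core_eq by blast
  then show "mv_of \<V> x \<subseteq> S"
    using mv_of_star[OF \<open>x \<in> cells L\<close>] unfolding compatible_def by blast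
qed

text \<open>A cell other than its top cell steps to it, so a future of the top cell yields one of
  \<open>x\<close>. \<open>Inv\<close> speaks of top cells, while \<open>face_step\<close> ends at
  an arbitrary cell; this lemma and its counterpart for pasts bridge the two.\<close>

lemma viable_forward_from_star:
  assumes "x \<in> N" "N \<subseteq> cells L" "viable (forward_step L \<V>) N (star L \<V> x)"
  shows "viable (forward_step L \<V>) N x"
proof (cases "x = star L \<V> x")
  case False
  then have "star L \<V> x \<in> Pi_mv L \<V> x"
    using star_step assms(1,2) by blast
  then show ?thesis
    by (rule viable_step[of x N, OF assms(1) _ assms(3)])
qed (use assms(3) in simp)

lemma viable_backward_to_star:
  assumes "x \<in> cells L" "star L \<V> x \<in> N" "viable (backward_step L \<V>) N x"
  shows "viable (backward_step L \<V>) N (star L \<V> x)"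
proof (cases "x = star L \<V> x")
  case False
  then have "star L \<V> x \<in> Pi_mv L \<V> x"
    using star_step assms(1) by blast
  then show ?thesis
    by (rule viable_step[of _ N, OF assms(2) _ assms(3)])
qed (use assms(3) in simp)

section \<open>Attractors and closed sets, repellers and open sets\<close>

lemma Inv_trapping_region_closed:
  assumes X: "invariant L \<V> (cells L)" and N: "trapping_region L \<V> N"
    and S: "invariant L \<V> (Inv L \<V> N)"
  shows "closedin (face_topology L) (Inv L \<V> N)"
proof -
  have N': "N \<subseteq> cells L" "compatible \<V> N" "Pi_image L \<V> N \<subseteq> N"
    using N unfolding trapping_region_def by auto
  have lower: "y \<in> Inv L \<V> N" if xy: "x \<in> Inv L \<V> N" "(y, x) \<in> face_order L" for x y
  proof (cases "y \<in> mv_of \<V> x")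
    case True
    then show ?thesis
      using xy(1) invariant_compatible[OF S] unfolding compatible_def by blast
  next
    case False
    have x: "x \<in> N" "viable (backward_step L \<V>) N (star L \<V> x)"
      using xy(1) unfolding Inv_compatible[OF N'(1,2)] by auto
    \<comment> \<open>The trapping region \<open>N\<close> is closed, hence contains the face
      \<open>y\<close> of \<open>x\<close>.\<close>
    have y: "y \<in> N" "y \<in> cells L"
      using Pi_image_subset_iff_closed[OF N'(1,2)] N' x(1) xy(2)
      unfolding closedin_iff_lower by blast+
    have sy: "star L \<V> y \<in> N"
      using y N'(2) star_mem unfolding compatible_def by blast
    \<comment> \<open>The past of the top cell of \<open>x\<close> is continued by the step from
      that cell to \<open>y\<close>.\<close>
    have "viable (backward_step L \<V>) N y"
      by (rule viable_step[of y N, OF y(1) face_step[OF xy(2) False] x(2)])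
    then have "viable (backward_step L \<V>) N (star L \<V> y)"
      by (rule viable_backward_to_star[OF y(2) sy])
    \<comment> \<open>The future comes from invariance of the whole complex and is then confined by
      the trapping property.\<close>
    moreover have "y \<in> Inv L \<V> (cells L)"
      using X y(2) unfolding invariant_def by simp
    then have "viable (forward_step L \<V>) (cells L) (star L \<V> y)"
      by (simp add: Inv_compatible[OF order_refl invariant_compatible[OF X]])
    then have "viable (forward_step L \<V>) N (star L \<V> y)"
      by (rule viable_trapped[OF _ sy]) (use N'(3) in \<open>auto simp: Pi_image_def\<close>)
    ultimately show ?thesis
      using y(1) unfolding Inv_compatible[OF N'(1,2)] by simp
  qed
  then show ?thesis
    using S unfolding closedin_iff_lower invariant_def by blast
qed

text \<open>The roles of past and future are exchanged: for \<open>y\<close> above \<open>x\<close>,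
  the top cell of \<open>y\<close> steps down to \<open>x\<close> and inherits its future, while the
  past is taken from the whole complex and confined by backward trapping.\<close>

lemma Inv_backward_trapping_region_open:
  assumes X: "invariant L \<V> (cells L)" and N: "backward_trapping_region L \<V> N"
    and S: "invariant L \<V> (Inv L \<V> N)"
  shows "openin (face_topology L) (Inv L \<V> N)"
proof -
  have N': "N \<subseteq> cells L" "compatible \<V> N" "Pi_preimage L \<V> N \<subseteq> N"
    using N unfolding backward_trapping_region_def by auto
  have upper: "y \<in> Inv L \<V> N" if xy: "x \<in> Inv L \<V> N" "(x, y) \<in> face_order L" for x y
  proof (cases "x \<in> mv_of \<V> y")
    case True
    then have "y \<in> mv_of \<V> x"
      using face_order_cells[OF xy(2)] mv_of_cong mem_mv_of by blast
    then show ?thesis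
      using xy(1) invariant_compatible[OF S] unfolding compatible_def by blast
  next
    case False
    have x: "x \<in> N" "viable (forward_step L \<V>) N (star L \<V> x)"
      using xy(1) unfolding Inv_compatible[OF N'(1,2)] by auto
    have y: "y \<in> N" "y \<in> cells L"
      using Pi_preimage_subset_iff_open[OF N'(1,2)] N' x(1) xy(2)
      unfolding openin_iff_upper by blast+
    have sy: "star L \<V> y \<in> N"
      using y N'(2) star_mem unfolding compatible_def by blast
    \<comment> \<open>The future known so far starts at the top cell of \<open>x\<close>, but the
      step from the top cell of \<open>y\<close> lands on \<open>x\<close> itself.\<close>
    have "viable (forward_step L \<V>) N x"
      by (rule viable_forward_from_star[OF x(1) N'(1) x(2)])
    then have "viable (forward_step L \<V>) N (star L \<V> y)"
      by (rule viable_step[of _ N "forward_step L \<V>", OF sy face_step[OF xy(2) False]])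
    moreover have "y \<in> Inv L \<V> (cells L)"
      using X y(2) unfolding invariant_def by simp
    then have "viable (backward_step L \<V>) (cells L) (star L \<V> y)"
      by (simp add: Inv_compatible[OF order_refl invariant_compatible[OF X]])
    then have "viable (backward_step L \<V>) N (star L \<V> y)"
      by (rule viable_trapped[OF _ sy])
        (use N'(3) in \<open>auto simp: Pi_preimage_def Pi_mv_def\<close>)
    ultimately show ?thesis
      using y(1) unfolding Inv_compatible[OF N'(1,2)] by simp
  qed
  then show ?thesis
    using S unfolding openin_iff_upper invariant_def by blast
qed

lemma attractor_iff_closed:
  assumes "invariant L \<V> (cells L)" "invariant L \<V> S"
  shows "attractor L \<V> S \<longleftrightarrow> closedin (face_topology L) S"
proof
  assume "attractor L \<V> S"
  then show "closedin (face_topology L) S"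
    using Inv_trapping_region_closed assms unfolding attractor_def by blast
next
  assume "closedin (face_topology L) S"
  then have "trapping_region L \<V> S" "S = Inv L \<V> S"
    using assms(2) invariant_compatible Pi_image_subset_iff_closed
    unfolding trapping_region_def invariant_def by auto
  then show "attractor L \<V> S"
    unfolding attractor_def by blast
qed

lemma repeller_iff_open:
  assumes "invariant L \<V> (cells L)" "invariant L \<V> S"
  shows "repeller L \<V> S \<longleftrightarrow> openin (face_topology L) S"
proof
  assume "repeller L \<V> S"
  then show "openin (face_topology L) S"
    using Inv_backward_trapping_region_open assms unfolding repeller_def by blast
next
  assume "openin (face_topology L) S"
  then have "backward_trapping_region L \<V> S" "S = Inv L \<V> S"
    using assms(2) invariant_compatible Pi_preimage_subset_iff_open
    unfolding backward_trapping_region_def invariant_def by auto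
  then show "repeller L \<V> S"
    unfolding repeller_def by blast
qed

end

theorem theorem2p1:
  fixes L :: "('a, 'r::{ring, monoid_mult}) complex_data"
    and \<V> :: "'a set set" and S :: "'a set"
  assumes "lefschetz_complex L"
    and "multivector_field L \<V>"
    and "invariant L \<V> (cells L)"
    and "isolated_invariant L \<V> S"
  shows "(attractor L \<V> S \<longleftrightarrow> closedin (face_topology L) S) \<and>
         (repeller L \<V> S \<longleftrightarrow> openin (face_topology L) S)"
  using attractor_iff_closed[OF assms(1-3)] repeller_iff_open[OF assms(1-3)] assms(4)
  unfolding isolated_invariant_def by blast

end
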